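(* Let $X$ be a bounded lattice and let $M(X)=\mathbb{Z}^{\oplus X}/J$ be the abelian group representing the functor $\mathcal{M}(X,-)$. Then $M(X)$ has a ring structure, induced by the meet operation of $X$ (that is, determined by $[x]\cdot[y]=[x\wedge y]$ for $x,y\in X$), and as a ring it is isomorphic to $\mathbb{Z}[X]/I$. The ring structure on $M(X)$ is functorial in $X$: every morphism of bounded lattices $f:X\to X'$ induces a ring homomorphism $f_*:M(X)\to M(X')$, $[x]\mapsto[f(x)]$.
   Context: All rings are commutative with identity. A bounded lattice $X$ has a least element $0_X$ and a greatest element $1_X$; a morphism of bounded lattices preserves $\wedge$, $\vee$, $0$ and $1$. For an abelian group $B$, a ($B$-valued) measure on $X$ is a function $\nu:X\to B$ with $\nu(0_X)=0$ and, for all $k\ge 2$ and all $x_1,\dots,x_k\in X$, \[ \nu(x_1\vee\dots\vee x_k)=\sum_{s=1}^k(-1)^{s+1}\sum_{1\leq i_1<\dots<i_s\leq k}\nu(x_{i_1}\wedge\dots\wedge x_{i_s}); \] $\mathcal{M}(X,B)$ is the abelian group of all such measures. $\mathbb{Z}^{\oplus X}$ is the free abelian group on the set $X$ and $J$ is its subgroup generated by $0_X$ and all elements \[ x_1\vee\dots\vee x_k-\sum_{s=1}^k(-1)^{s+1}\sum_{1\leq i_1<\dots<i_s\leq k}x_{i_1}\wedge\dots\wedge x_{i_s},\qquad k\ge2,\ x_1,\dots,x_k\in X. \] $[x]$ denotes the class of $x\in X$ in $M(X)=\mathbb{Z}^{\oplus X}/J$; this group represents $\mathcal{M}(X,-)$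 on abelian groups. $\mathbb{Z}[X]$ is the polynomial ring with one variable for each element of $X$, and $I\subseteq\mathbb{Z}[X]$ is the ideal generated by $0_X$, $1_X-1$, and $x\wedge y-xy$, $x\vee y-x-y+xy$ for all $x,y\in X$. *)

theory Defs
  imports "HOL-Algebra.Free_Abelian_Groups" "HOL-Algebra.QuotRing"
    "HOL-Algebra.Algebraic_Closure_Type"
begin

text \<open>
  The bounded lattice \<open>X\<close> is a type of class \<^class>\<open>bounded_lattice\<close>; neither distributivity nor
  \<open>bot \<noteq> top\<close> is assumed.
  A choice of indices \<open>i\<^sub>1 < \<dots> < i\<^sub>s\<close> in \<open>{1..k}\<close> is encoded as a subset \<open>I\<close> of cardinality \<open>s\<close>.
\<close>

definition lattice_relations :: "('a::bounded_lattice \<Rightarrow>\<^sub>0 int) set" where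
  "lattice_relations =
     {frag_of bot} \<union>
     {frag_of (Sup_fin (x ` {1..k})) -
        (\<Sum>s=1..k. frag_cmul ((-1) ^ (s + 1))
           (\<Sum>I | I \<subseteq> {1..k} \<and> card I = s. frag_of (Inf_fin (x ` I))))
      | (k::nat) (x::nat \<Rightarrow> 'a). k \<ge> 2}"

definition lattice_J :: "('a::bounded_lattice \<Rightarrow>\<^sub>0 int) set" where
  "lattice_J = generate (free_Abelian_group UNIV) lattice_relations"

definition lattice_M :: "('a::bounded_lattice \<Rightarrow>\<^sub>0 int) set monoid" where
  "lattice_M = free_Abelian_group UNIV Mod lattice_J"

definition lattice_M_class :: "'a::bounded_lattice \<Rightarrow> ('a \<Rightarrow>\<^sub>0 int) set" where
  "lattice_M_class x = lattice_J #>\<^bsub>free_Abelian_group UNIV\<^esub> frag_of x"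

text \<open>The abelian group \<open>B\<close> is written multiplicatively, as always in \<^theory>\<open>HOL-Algebra.Group\<close>.\<close>

definition lattice_measure :: "('b, 'm) monoid_scheme \<Rightarrow> ('a::bounded_lattice \<Rightarrow> 'b) \<Rightarrow> bool" where
  "lattice_measure B \<nu> \<longleftrightarrow>
     range \<nu> \<subseteq> carrier B \<and> \<nu> bot = \<one>\<^bsub>B\<^esub> \<and>
     (\<forall>(k::nat) (x::nat \<Rightarrow> 'a). k \<ge> 2 \<longrightarrow>
        \<nu> (Sup_fin (x ` {1..k})) =
        finprod B (\<lambda>s. finprod B (\<lambda>I. \<nu> (Inf_fin (x ` I))) {I. I \<subseteq> {1..k} \<and> card I = s}
          [^]\<^bsub>B\<^esub> ((-1) ^ (s + 1) :: int)) {1..k})"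

text \<open>
  A ring structure on the abelian group \<^const>\<open>lattice_M\<close> whose multiplication is induced by meet.
  Its unit is not prescribed.
\<close>

definition meet_ring_structure :: "('a::bounded_lattice \<Rightarrow>\<^sub>0 int) set ring \<Rightarrow> bool" where
  "meet_ring_structure R \<longleftrightarrow>
     cring R \<and> add_monoid R = lattice_M \<and>
     (\<forall>x y. lattice_M_class x \<otimes>\<^bsub>R\<^esub> lattice_M_class y = lattice_M_class (inf x y))"

text \<open>\<open>\<int>[X]\<close>: monomials are the finitely supported exponent functions \<open>X \<Rightarrow>\<^sub>0 nat\<close>.\<close>

type_synonym 'a int_mpoly = "('a \<Rightarrow>\<^sub>0 nat) \<Rightarrow>\<^sub>0 int"

definition int_var :: "'a \<Rightarrow> 'a int_mpoly" where
  "int_var x = Poly_Mapping.single (Poly_Mapping.single x 1) 1"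

definition int_mpoly_ring :: "'a int_mpoly ring" where
  "int_mpoly_ring = ring_of_type_algebra"

definition lattice_ideal :: "'a::bounded_lattice int_mpoly set" where
  "lattice_ideal = Idl\<^bsub>int_mpoly_ring\<^esub>
     ({int_var bot, int_var Orderings.top - 1} \<union>
      {int_var (inf x y) - int_var x * int_var y | x y. True} \<union>
      {int_var (sup x y) - int_var x - int_var y + int_var x * int_var y | x y. True})"

definition bounded_lattice_hom :: "('a::bounded_lattice \<Rightarrow> 'b::bounded_lattice) \<Rightarrow> bool" where
  "bounded_lattice_hom f \<longleftrightarrow>
     f bot = bot \<and> f Orderings.top = Orderings.top \<and>
     (\<forall>x y. f (inf x y) = inf (f x) (f y)) \<and> (\<forall>x y. f (sup x y) = sup (f x) (f y))"

text \<open>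
  The map on quotients induced by the \<open>\<int>\<close>-linear extension of \<open>f\<close>, in the style of
  \<^const>\<open>rcoset_mult\<close>: if the linear extension maps \<open>J\<close> into \<open>J\<close>, all members of the union coincide.
\<close>

definition lattice_M_map ::
    "('a::bounded_lattice \<Rightarrow> 'b::bounded_lattice) \<Rightarrow> ('a \<Rightarrow>\<^sub>0 int) set \<Rightarrow> ('b \<Rightarrow>\<^sub>0 int) set" where
  "lattice_M_map f C =
     (\<Union>c\<in>C. lattice_J #>\<^bsub>free_Abelian_group UNIV\<^esub> frag_extend (\<lambda>x. frag_of (f x)) c)"

lemma lattice_relations_carrier: "lattice_relations \<subseteq> carrier (free_Abelian_group UNIV)"
  by auto

lemma lattice_J_normal: "lattice_J \<lhd> free_Abelian_group UNIV"
  unfolding lattice_J_def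
  by (intro comm_group.subgroup_imp_normal abelian_free_Abelian_group group.generate_is_subgroup
      group_free_Abelian_group lattice_relations_carrier)

lemma hom_free_sum:
  assumes B: "comm_group B" and h: "h \<in> hom (free_Abelian_group UNIV) B"
    and "finite A"
  shows "h (sum c A) = finprod B (\<lambda>i. h (c i)) A"
proof -
  interpret B: comm_group B by (rule B)
  have c: "h y \<in> carrier B" for y
    using h by (auto simp: hom_def Pi_def)
  show ?thesis
    using \<open>finite A\<close>
  proof (induction A)
    case empty
    then show ?case
      using hom_one[OF h group_free_Abelian_group B.is_group] by simp
  next
    case (insert a A)
    have "h (c a + sum c A) = h (c a) \<otimes>\<^bsub>B\<^esub> h (sum c A)"
      using hom_mult[OF h, of "c a" "sum c A"] by simp
    with insert c show ?case by (simp add: Pi_def)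
  qed
qed

lemma hom_relation:
  assumes B: "comm_group B" and h: "h \<in> hom (free_Abelian_group UNIV) B"
    and \<nu>: "\<And>x. h (frag_of x) = \<nu> x"
  shows "h (\<Sum>s=1..k::nat. frag_cmul ((-1) ^ (s + 1))
           (\<Sum>I | I \<subseteq> {1..k} \<and> card I = s. frag_of (Inf_fin (x ` I)))) =
         finprod B (\<lambda>s. finprod B (\<lambda>I. \<nu> (Inf_fin (x ` I))) {I. I \<subseteq> {1..k} \<and> card I = s}
           [^]\<^bsub>B\<^esub> ((-1) ^ (s + 1) :: int)) {1..k}"
proof -
  interpret B: comm_group B by (rule B)
  interpret gh: group_hom "free_Abelian_group UNIV" B h
    by (simp add: group_hom_def group_hom_axioms_def h B.is_group)
  have p: "h (frag_cmul n y) = h y [^]\<^bsub>B\<^esub> n" for n y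
    using gh.hom_int_pow[of y n] by simp
  have fin: "finite {I. I \<subseteq> {1..k} \<and> card I = s}" for s
    by (rule finite_subset[of _ "Pow {1..k}"]) auto
  have q: "h (\<Sum>I | I \<subseteq> {1..k} \<and> card I = s. frag_of (Inf_fin (x ` I))) =
      finprod B (\<lambda>I. \<nu> (Inf_fin (x ` I))) {I. I \<subseteq> {1..k} \<and> card I = s}" for s
    by (subst hom_free_sum[OF B h fin]) (simp add: \<nu>)
  show ?thesis
    by (subst hom_free_sum[OF B h]) (simp_all only: p q finite_atLeastAtMost)
qed

text \<open>
  \<^const>\<open>lattice_M\<close> represents \<open>\<M>(X,-)\<close>: composition with \<^const>\<open>lattice_M_class\<close> is a bijection from
  homomorphisms to measures.
\<close>

lemma lattice_measure_of_hom:
  fixes g :: "('a::bounded_lattice \<Rightarrow>\<^sub>0 int) set \<Rightarrow> 'b"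
  assumes B: "comm_group B" and g: "g \<in> hom lattice_M B"
  shows "lattice_measure B (\<lambda>x. g (lattice_M_class x))"
proof -
  let ?F = "free_Abelian_group UNIV :: ('a \<Rightarrow>\<^sub>0 int) monoid"
  interpret B: comm_group B by (rule B)
  define h where "h = (\<lambda>c. g (lattice_J #>\<^bsub>?F\<^esub> c))"
  have h: "h \<in> hom ?F B"
    using hom_compose[OF normal.r_coset_hom_Mod[OF lattice_J_normal] g[unfolded lattice_M_def]]
    by (simp add: h_def comp_def)
  have \<nu>: "h (frag_of x) = g (lattice_M_class x)" for x
    by (simp add: h_def lattice_M_class_def)
  have J: "h c = \<one>\<^bsub>B\<^esub>" if "c \<in> lattice_relations" for c
  proof -
    have "c \<in> lattice_J"
      unfolding lattice_J_def using that by (rule generate.incl)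
    then have "lattice_J #>\<^bsub>?F\<^esub> c = lattice_J #>\<^bsub>?F\<^esub> \<one>\<^bsub>?F\<^esub>"
      by (metis group.coset_join2 group_free_Abelian_group carrier_free_Abelian_group_iff
          lattice_J_normal normal_imp_subgroup subgroup.one_closed subset_UNIV)
    then have "h c = h \<one>\<^bsub>?F\<^esub>"
      by (simp add: h_def)
    then show ?thesis
      using hom_one[OF h group_free_Abelian_group B.is_group] by simp
  qed
  have c: "h y \<in> carrier B" for y
    using h by (auto simp: hom_def Pi_def)
  have eq: "h a = h b" if "a - b \<in> lattice_relations" for a b
    using hom_mult[OF h, of "a - b" b] J[OF that] c[of b] by simp
  show ?thesis
    unfolding lattice_measure_def
  proof (intro conjI allI impI)
    show "range (\<lambda>x. g (lattice_M_class x)) \<subseteq> carrier B"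
      using c by (auto simp flip: \<nu>)
    show "g (lattice_M_class bot) = \<one>\<^bsub>B\<^esub>"
      using J[of "frag_of bot"] by (simp add: \<nu> lattice_relations_def)
    fix k :: nat and x :: "nat \<Rightarrow> 'a" assume "2 \<le> k"
    then have "h (frag_of (Sup_fin (x ` {1..k}))) = h (\<Sum>s=1..k. frag_cmul ((-1) ^ (s + 1))
           (\<Sum>I | I \<subseteq> {1..k} \<and> card I = s. frag_of (Inf_fin (x ` I))))"
      by (intro eq) (auto simp: lattice_relations_def)
    then show "g (lattice_M_class (Sup_fin (x ` {1..k}))) =
        finprod B (\<lambda>s. finprod B (\<lambda>I. g (lattice_M_class (Inf_fin (x ` I))))
          {I. I \<subseteq> {1..k} \<and> card I = s} [^]\<^bsub>B\<^esub> ((-1) ^ (s + 1) :: int)) {1..k}"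
      unfolding hom_relation[OF B h \<nu>] \<nu> .
  qed
qed

lemma lattice_M_represents:
  fixes \<nu> :: "'a::bounded_lattice \<Rightarrow> 'b"
  assumes B: "comm_group B" and m: "lattice_measure B \<nu>"
  shows "\<exists>!g. g \<in> hom lattice_M B \<and> g \<in> extensional (carrier lattice_M) \<and>
           (\<forall>x. g (lattice_M_class x) = \<nu> x)"
proof -
  let ?F = "free_Abelian_group UNIV :: ('a \<Rightarrow>\<^sub>0 int) monoid"
  interpret B: comm_group B by (rule B)
  have J_group: "group (lattice_M :: ('a \<Rightarrow>\<^sub>0 int) set monoid)"
    unfolding lattice_M_def by (rule normal.factorgroup_is_group[OF lattice_J_normal])
  obtain h where h: "h \<in> hom ?F B" and h\<nu>: "\<And>x. h (frag_of x) = \<nu> x"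
    using B.free_Abelian_group_universal[of \<nu> UNIV] m
    unfolding lattice_measure_def by (metis UNIV_I)
  interpret gh: group_hom ?F B h
    by (simp add: group_hom_def group_hom_axioms_def h B.is_group)
  have sub: "lattice_J \<subseteq> kernel ?F B h"
    unfolding lattice_J_def
  proof (rule group.generate_subgroup_incl[OF group_free_Abelian_group _ gh.subgroup_kernel], rule)
    fix c :: "'a \<Rightarrow>\<^sub>0 int" assume c: "c \<in> lattice_relations"
    have "h c = \<one>\<^bsub>B\<^esub>"
    proof (cases "c = frag_of bot")
      case True
      then show ?thesis using m by (simp add: h\<nu> lattice_measure_def)
    next
      case False
      with c obtain k and x :: "nat \<Rightarrow> 'a" where k: "k \<ge> (2::nat)" and
        c': "c = frag_of (Sup_fin (x ` {1..k})) - (\<Sum>s=1..k. frag_cmul ((-1) ^ (s + 1))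
           (\<Sum>I | I \<subseteq> {1..k} \<and> card I = s. frag_of (Inf_fin (x ` I))))" (is "_ = ?a - ?b")
        unfolding lattice_relations_def by blast
      have "h ?a = h ?b"
        unfolding hom_relation[OF B h h\<nu>] h\<nu>
        using m k unfolding lattice_measure_def by blast
      moreover have "h ?a = h c \<otimes>\<^bsub>B\<^esub> h ?b"
        using gh.hom_mult[of c ?b] by (simp add: c')
      ultimately have "h c \<otimes>\<^bsub>B\<^esub> h ?b = \<one>\<^bsub>B\<^esub> \<otimes>\<^bsub>B\<^esub> h ?b"
        using gh.hom_closed[of ?b] by simp
      then show ?thesis
        by (rule B.right_cancel[THEN iffD1, rotated -1]) (auto intro!: gh.hom_closed)
    qed
    then show "c \<in> kernel ?F B h"
      by (simp add: kernel_def)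
  qed
  obtain g where g: "g \<in> hom (?F Mod lattice_J) B"
    and gh: "\<And>c. c \<in> carrier ?F \<Longrightarrow> g (lattice_J #>\<^bsub>?F\<^esub> c) = h c"
    using gh.FactGroup_universal_kernel[OF lattice_J_normal sub] by blast
  have cls: "lattice_M_class x \<in> carrier lattice_M" for x :: 'a
    by (auto simp: lattice_M_class_def lattice_M_def carrier_FactGroup)
  show ?thesis
  proof (rule ex_ex1I)
    have "restrict g (carrier lattice_M) \<in> hom lattice_M B"
      using g[folded lattice_M_def] J_group
      by (auto simp: hom_def group.is_monoid monoid.m_closed)
    moreover have "restrict g (carrier lattice_M) (lattice_M_class x) = \<nu> x" for x
      using cls[of x] gh[of "frag_of x"] by (simp add: lattice_M_class_def h\<nu>)
    ultimately show "\<exists>g. g \<in> hom lattice_M B \<and> g \<in> extensional (carrier lattice_M) \<and>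
        (\<forall>x. g (lattice_M_class x) = \<nu> x)"
      by blast
  next
    fix g1 g2 :: "('a \<Rightarrow>\<^sub>0 int) set \<Rightarrow> 'b"
    assume 1: "g1 \<in> hom lattice_M B \<and> g1 \<in> extensional (carrier lattice_M) \<and>
        (\<forall>x. g1 (lattice_M_class x) = \<nu> x)"
      and 2: "g2 \<in> hom lattice_M B \<and> g2 \<in> extensional (carrier lattice_M) \<and>
        (\<forall>x. g2 (lattice_M_class x) = \<nu> x)"
    have hom: "(\<lambda>c. g' (lattice_J #>\<^bsub>?F\<^esub> c)) \<in> hom ?F B" if "g' \<in> hom lattice_M B" for g'
      using hom_compose[OF normal.r_coset_hom_Mod[OF lattice_J_normal] that[unfolded lattice_M_def]]
      by (simp add: comp_def)
    interpret h1: group_hom ?F B "\<lambda>c. g1 (lattice_J #>\<^bsub>?F\<^esub> c)"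
      using hom[of g1] 1 by (simp add: group_hom_def group_hom_axioms_def B.is_group)
    interpret h2: group_hom ?F B "\<lambda>c. g2 (lattice_J #>\<^bsub>?F\<^esub> c)"
      using hom[of g2] 2 by (simp add: group_hom_def group_hom_axioms_def B.is_group)
    have "g1 (lattice_J #>\<^bsub>?F\<^esub> c) = g2 (lattice_J #>\<^bsub>?F\<^esub> c)" for c
    proof (induction c rule: free_Abelian_group_induct[where S = UNIV])
      case 1
      then show ?case by simp
    next
      case 2
      then show ?case using h1.hom_one h2.hom_one by simp
    next
      case (3 x y)
      have "x - y = x \<otimes>\<^bsub>?F\<^esub> inv\<^bsub>?F\<^esub> y" by simp
      with 3 show ?case
        by (simp only: h1.hom_mult h2.hom_mult h1.hom_inv h2.hom_inv group.inv_closed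
            group_free_Abelian_group carrier_free_Abelian_group_iff subset_UNIV)
    next
      case (4 a)
      then show ?case using 1 2 by (simp flip: lattice_M_class_def)
    qed
    then have "g1 C = g2 C" if "C \<in> carrier lattice_M" for C
      using that by (auto simp: lattice_M_def carrier_FactGroup)
    then show "g1 = g2"
      using 1 2 by (meson extensionalityI)
  qed
qed

end

theory Submission
  imports Defs
begin

text \<open>
  Extend meet bilinearly to a product on \<open>\<int>\<^sup>\<oplus>\<^sup>X\<close>. The point is that \<open>J\<close> is an ideal, although \<open>X\<close> is not
  assumed distributive. Write \<open>E\<^sub>k\<close> for the inclusion-exclusion sum of \<open>x\<^sub>1, \<dots>, x\<^sub>k\<close> and \<open>s\<close> for their join;
  then \<open>E\<^sub>k\<^sub>+\<^sub>1 = E\<^sub>k + y - y \<sqinter> E\<^sub>k\<close> for \<open>x\<^sub>k\<^sub>+\<^sub>1 = y\<close>. Modulo \<open>J\<close> we have \<open>s \<squnion> y = E\<^sub>k\<^sub>+\<^sub>1\<close>,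
  \<open>s \<squnion> y = s + y - s \<sqinter> y\<close> and \<open>s = E\<^sub>k\<close>, hence \<open>s \<sqinter> y = y \<sqinter> E\<^sub>k\<close>: meet with \<open>y\<close> maps the
  relations into \<open>J\<close>.

  The map sending a monomial to the meet of its variables is a surjective ring homomorphism from
  \<open>\<int>[X]\<close> onto \<open>M(X)\<close> that kills \<open>I\<close>. Conversely the linear map \<open>\<int>\<^sup>\<oplus>\<^sup>X \<rightarrow> \<int>[X]\<close> sending \<open>x\<close> to its variable
  maps \<open>J\<close> into \<open>I\<close> (by the same recursion for \<open>E\<^sub>k\<close>) and inverts it modulo \<open>I\<close>, so the kernel
  is exactly \<open>I\<close>.
\<close>

section \<open>Meet translations and inclusion-exclusion sums\<close>

definition meet_translate :: "'a::bounded_lattice \<Rightarrow> ('a \<Rightarrow>\<^sub>0 int) \<Rightarrow> ('a \<Rightarrow>\<^sub>0 int)" where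
  "meet_translate y = frag_extend (\<lambda>x. frag_of (inf y x))"

definition meet_mult :: "('a::bounded_lattice \<Rightarrow>\<^sub>0 int) \<Rightarrow> ('a \<Rightarrow>\<^sub>0 int) \<Rightarrow> ('a \<Rightarrow>\<^sub>0 int)" where
  "meet_mult a b = frag_extend (\<lambda>y. meet_translate y b) a"

text \<open>Indexing by all nonempty subsets, rather than level by level in the cardinality, turns
  the passage from \<open>k\<close> to \<open>Suc k\<close> into a partition of the index
  sets.\<close>

definition incl_excl :: "(nat \<Rightarrow> 'a::bounded_lattice) \<Rightarrow> nat \<Rightarrow> ('a \<Rightarrow>\<^sub>0 int)" where
  "incl_excl x k =
     (\<Sum>I\<in>Pow {1..k} - {{}}. frag_cmul ((-1) ^ (card I + 1)) (frag_of (Inf_fin (x ` I))))"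

lemma incl_excl_by_card:
  "(\<Sum>s=1..k. frag_cmul ((-1) ^ (s + 1))
      (\<Sum>I | I \<subseteq> {1..k} \<and> card I = s. frag_of (Inf_fin (x ` I)))) = incl_excl x k"
proof -
  let ?g = "\<lambda>I. frag_cmul ((-1) ^ (card I + 1)) (frag_of (Inf_fin (x ` I)))"
  have sets: "{I \<in> Pow {1..k} - {{}}. card I = s} = {I. I \<subseteq> {1..k} \<and> card I = s}"
    if "s \<in> {1..k}" for s
    using that by auto
  \<comment> \<open>The cardinalities \<open>1..k\<close> account for every nonempty index set, so
    grouping by cardinality loses no term.\<close>
  have "card ` (Pow {1..k} - {{}}) \<subseteq> {1..k}"
  proof (rule image_subsetI)
    fix I assume I: "I \<in> Pow {1..k} - {{}}"
    then have "finite I" by (auto intro: finite_subset)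
    then show "card I \<in> {1..k}"
      using I card_mono[of "{1..k}" I] by (auto simp: Suc_le_eq card_gt_0_iff)
  qed
  then have "incl_excl x k = (\<Sum>s=1..k. \<Sum>I | I \<in> Pow {1..k} - {{}} \<and> card I = s. ?g I)"
    unfolding incl_excl_def by (intro sum.group[symmetric]) auto
  also have "\<dots> = (\<Sum>s=1..k. \<Sum>I | I \<subseteq> {1..k} \<and> card I = s. ?g I)"
    by (intro sum.cong refl) (simp only: sets)
  finally show ?thesis
    by (simp add: frag_cmul_sum)
qed

lemma lattice_relations_eq:
  "lattice_relations = insert (frag_of bot)
     {frag_of (Sup_fin (x ` {1..k})) - incl_excl x k | (k::nat) x. k \<ge> 2}"
  unfolding lattice_relations_def incl_excl_by_card by auto

lemma incl_excl_Suc_0 [simp]: "incl_excl x (Suc 0) = frag_of (x 1)"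
proof -
  have "Pow {1..Suc 0} - {{}} = {{1}}" by auto
  then show ?thesis
    by (simp add: incl_excl_def)
qed

text \<open>Split the index sets according to whether they contain the last index.\<close>

lemma incl_excl_Suc:
  "incl_excl x (Suc k) =
     incl_excl x k + frag_of (x (Suc k)) - meet_translate (x (Suc k)) (incl_excl x k)"
proof -
  let ?y = "x (Suc k)"
  let ?g = "\<lambda>I. frag_cmul ((-1) ^ (card I + 1)) (frag_of (Inf_fin (x ` I)))"
  let ?P = "Pow {1..k} - {{}}"
  have Suc_eq: "{1..Suc k} = insert (Suc k) {1..k}" by auto
  have split: "Pow {1..Suc k} - {{}} = (?P \<union> {{Suc k}}) \<union> insert (Suc k) ` ?P"
    unfolding Suc_eq Pow_insert by auto
  have inj: "inj_on (insert (Suc k)) ?P"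
    by (rule inj_onI) (metis Diff_iff Pow_iff atLeastAtMost_iff insert_ident not_less_eq_eq order_refl subsetD)
  \<comment> \<open>Adjoining the last index flips the sign and meets the term with
    \<open>?y\<close>. The singleton of the last index has no nonempty set to come from and
    contributes the separate term \<open>frag_of ?y\<close>.\<close>
  have g_insert: "?g (insert (Suc k) I) = - meet_translate ?y (?g I)" if "I \<in> ?P" for I
  proof -
    have "finite I" "I \<noteq> {}" "Suc k \<notin> I"
      using that finite_subset[of I "{1..k}"] by auto
    then show ?thesis
      by (simp add: meet_translate_def frag_extend_cmul)
  qed
  have "incl_excl x (Suc k) = sum ?g (?P \<union> {{Suc k}}) + sum ?g (insert (Suc k) ` ?P)"
    unfolding incl_excl_def split by (rule sum.union_disjoint) auto
  also have "sum ?g (?P \<union> {{Suc k}}) = incl_excl x k + frag_of ?y"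
    unfolding incl_excl_def by (subst sum.union_disjoint) auto
  also have "sum ?g (insert (Suc k) ` ?P) = (\<Sum>I\<in>?P. - meet_translate ?y (?g I))"
    unfolding sum.reindex[OF inj] comp_def by (rule sum.cong[OF refl g_insert])
  also have "\<dots> = - meet_translate ?y (incl_excl x k)"
    unfolding incl_excl_def meet_translate_def
    by (simp add: frag_extend_sum comp_def sum_negf)
  finally show ?thesis by simp
qed

lemma Inf_fin_hom:
  assumes f: "\<And>x y. f (inf x y) = inf (f x) (f y)" and N: "finite N" "N \<noteq> {}"
  shows "f (Inf_fin N) = Inf_fin (f ` N)"
  using N by (induction rule: finite_ne_induct) (simp_all add: f)

lemma Sup_fin_hom:
  assumes f: "\<And>x y. f (sup x y) = sup (f x) (f y)" and N: "finite N" "N \<noteq> {}"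
  shows "f (Sup_fin N) = Sup_fin (f ` N)"
  using N by (induction rule: finite_ne_induct) (simp_all add: f)

lemma frag_extend_incl_excl:
  assumes f: "\<And>x y. f (inf x y) = inf (f x) (f y)"
  shows "frag_extend (\<lambda>x. frag_of (f x)) (incl_excl x k) = incl_excl (f \<circ> x) k"
proof -
  have "f (Inf_fin (x ` I)) = Inf_fin ((f \<circ> x) ` I)" if "I \<in> Pow {1..k} - {{}}" for I
    using that Inf_fin_hom[of f "x ` I", OF f] finite_subset[of I "{1..k}"]
    by (auto simp: image_image)
  then show ?thesis
    unfolding incl_excl_def
    by (simp add: frag_extend_sum comp_def frag_extend_cmul del: One_nat_def)
qed

section \<open>Bilinear extension of meet\<close>

text \<open>Iterated differences of generators exhaust the free group, and a map preserving
  differences sends 0 to 0. Applied to one argument after the other, this reduces multilinear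
  identities to lattice elements.\<close>

lemma frag_eq_on_generators:
  fixes F G :: "('a \<Rightarrow>\<^sub>0 int) \<Rightarrow> 'c::ab_group_add"
  assumes "\<And>x y. F (x - y) = F x - F y" "\<And>x y. G (x - y) = G x - G y"
    and "\<And>x. F (frag_of x) = G (frag_of x)"
  shows "F c = G c"
proof (rule frag_induction[of c UNIV])
  show "F 0 = G 0" using assms(1)[of 0 0] assms(2)[of 0 0] by simp
qed (auto simp: assms)

lemma meet_translate_of [simp]: "meet_translate y (frag_of x) = frag_of (inf y x)"
  by (simp add: meet_translate_def)

lemma meet_translate_diff: "meet_translate y (a - b) = meet_translate y a - meet_translate y b"
  by (simp add: meet_translate_def frag_extend_diff)

lemma meet_mult_of_left [simp]: "meet_mult (frag_of y) b = meet_translate y b"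
  by (simp add: meet_mult_def)

lemma meet_mult_diff_left: "meet_mult (a - b) c = meet_mult a c - meet_mult b c"
  by (simp add: meet_mult_def frag_extend_diff)

lemma meet_mult_diff_right: "meet_mult c (a - b) = meet_mult c a - meet_mult c b"
  by (rule frag_eq_on_generators[where c = c])
    (simp_all add: meet_mult_diff_left meet_translate_diff)

lemma meet_mult_commute: "meet_mult a b = meet_mult b a"
proof (rule frag_eq_on_generators[where c = a])
  fix x
  show "meet_mult (frag_of x) b = meet_mult b (frag_of x)"
    by (rule frag_eq_on_generators[where c = b])
      (simp_all add: meet_mult_diff_left meet_mult_diff_right meet_translate_diff inf_commute)
qed (simp_all add: meet_mult_diff_left meet_mult_diff_right)

lemma meet_mult_assoc: "meet_mult (meet_mult a b) c = meet_mult a (meet_mult b c)"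
proof (rule frag_eq_on_generators[where c = a])
  fix x
  show "meet_mult (meet_mult (frag_of x) b) c = meet_mult (frag_of x) (meet_mult b c)"
  proof (rule frag_eq_on_generators[where c = b])
    fix y
    show "meet_mult (meet_mult (frag_of x) (frag_of y)) c
        = meet_mult (frag_of x) (meet_mult (frag_of y) c)"
      by (rule frag_eq_on_generators[where c = c])
        (simp_all add: meet_translate_diff inf_assoc)
  qed (simp_all add: meet_mult_diff_left meet_translate_diff)
qed (simp_all add: meet_mult_diff_left meet_mult_diff_right)

lemma meet_mult_add_left: "meet_mult (a + b) c = meet_mult a c + meet_mult b c"
  by (simp add: meet_mult_def frag_extend_add)

lemma meet_mult_top: "meet_mult (frag_of Orderings.top) a = a"
  by (simp add: meet_translate_def flip: frag_expansion)

section \<open>The relation subgroup is an ideal for the meet product\<close>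

lemma lattice_J_subgroup: "subgroup lattice_J (free_Abelian_group UNIV)"
  by (rule normal_imp_subgroup[OF lattice_J_normal])

lemma lattice_J_zero: "0 \<in> lattice_J"
  using subgroup.one_closed[OF lattice_J_subgroup] by simp

lemma lattice_J_add: "a \<in> lattice_J \<Longrightarrow> b \<in> lattice_J \<Longrightarrow> a + b \<in> lattice_J"
  using subgroup.m_closed[OF lattice_J_subgroup, of a b] by simp

lemma lattice_J_uminus: "a \<in> lattice_J \<Longrightarrow> - a \<in> lattice_J"
  using subgroup.m_inv_closed[OF lattice_J_subgroup, of a] by simp

lemma lattice_J_diff: "a \<in> lattice_J \<Longrightarrow> b \<in> lattice_J \<Longrightarrow> a - b \<in> lattice_J"
  using lattice_J_add[of a "- b"] lattice_J_uminus[of b] by simp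

lemma lattice_J_bot: "frag_of bot \<in> lattice_J"
  unfolding lattice_J_def by (rule generate.incl) (simp add: lattice_relations_eq)

lemma Sup_fin_atLeastAtMost_Suc:
  "k \<ge> 1 \<Longrightarrow> Sup_fin (x ` {1..Suc k}) = sup (Sup_fin (x ` {1..k})) (x (Suc k))"
proof -
  assume "k \<ge> 1"
  then have "Sup_fin (insert (x (Suc k)) (x ` {1..k})) = sup (x (Suc k)) (Sup_fin (x ` {1..k}))"
    by (intro Sup_fin.insert) auto
  moreover have "x ` {1..Suc k} = insert (x (Suc k)) (x ` {1..k})"
    by (simp add: atLeastAtMostSuc_conv)
  ultimately show ?thesis by (simp add: sup_commute)
qed

lemma lattice_J_incl_excl: "k \<ge> 1 \<Longrightarrow> frag_of (Sup_fin (x ` {1..k})) - incl_excl x k \<in> lattice_J"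
proof (cases "k = 1")
  case False
  moreover assume "k \<ge> 1"
  ultimately show ?thesis
    unfolding lattice_J_def
    by (intro generate.incl) (auto simp: lattice_relations_eq simp del: One_nat_def)
qed (simp add: lattice_J_zero)

lemma lattice_J_sup:
  "frag_of (sup x y) - frag_of x - frag_of y + frag_of (inf x y) \<in> lattice_J"
proof -
  \<comment> \<open>A family with entries \<open>x\<close>, \<open>y\<close> at the indices 1, 2:
    the relation wanted is the case \<open>k = 2\<close>.\<close>
  define z where "z i = (if i = (1::nat) then x else y)" for i
  have "Sup_fin (z ` {1..Suc 1}) = sup x y"
    by (subst Sup_fin_atLeastAtMost_Suc) (simp_all add: z_def)
  moreover have "incl_excl z (Suc 1) = frag_of x + frag_of y - frag_of (inf x y)"
    unfolding incl_excl_Suc by (simp add: z_def inf_commute)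
  ultimately have "frag_of (sup x y) - (frag_of x + frag_of y - frag_of (inf x y)) \<in> lattice_J"
    using lattice_J_incl_excl[of "Suc 1" z] by (simp only:)
  then show ?thesis by (simp add: algebra_simps)
qed

lemma lattice_J_induct [consumes 1, case_names bot incl_excl zero add uminus]:
  assumes "c \<in> lattice_J"
    and "P (frag_of bot)"
    and "\<And>x k. k \<ge> 2 \<Longrightarrow> P (frag_of (Sup_fin (x ` {1..k})) - incl_excl x k)"
    and "P 0" "\<And>a b. P a \<Longrightarrow> P b \<Longrightarrow> P (a + b)" "\<And>a. P a \<Longrightarrow> P (- a)"
  shows "P c"
proof -
  have rel: "P r" if "r \<in> lattice_relations" for r
    using that assms(2,3) by (auto simp: lattice_relations_eq)
  from assms(1) show ?thesis
    unfolding lattice_J_def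
    by (induction rule: generate.induct) (simp_all add: assms rel)
qed

text \<open>This replaces distributivity: in \<open>X\<close> itself, meeting with \<open>y\<close>
  need not commute with the join, but comparing relations of lengths 2, \<open>k\<close> and
  \<open>Suc k\<close> shows that it does modulo \<open>lattice_J\<close>.\<close>

lemma meet_translate_lattice_J: "c \<in> lattice_J \<Longrightarrow> meet_translate y c \<in> lattice_J"
proof (induction rule: lattice_J_induct)
  case bot
  then show ?case by (simp add: lattice_J_bot)
next
  case (incl_excl x k)
  \<comment> \<open>Append \<open>y\<close> as entry number \<open>Suc k\<close>; the first
    \<open>k\<close> entries, hence their join and inclusion-exclusion sum, stay the same.\<close>
  define z where "z = x(Suc k := y)"
  define s where "s = Sup_fin (x ` {1..k})"
  have agree: "z ` I = x ` I" if "I \<subseteq> {1..k}" for I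
    using that by (auto simp: z_def image_iff)
  have ie: "incl_excl z k = incl_excl x k"
    unfolding incl_excl_def by (intro sum.cong refl) (use agree in auto)
  have zs: "Sup_fin (z ` {1..k}) = s"
    using agree[of "{1..k}"] by (simp add: s_def)
  have "Sup_fin (z ` {1..Suc k}) = sup s y"
    using incl_excl by (subst Sup_fin_atLeastAtMost_Suc) (simp_all only: zs, auto simp: z_def)
  then have "frag_of (sup s y)
      - (incl_excl x k + frag_of y - meet_translate y (incl_excl x k)) \<in> lattice_J"
    using lattice_J_incl_excl[of "Suc k" z] by (simp add: incl_excl_Suc ie) (simp add: z_def)
  note lattice_J_diff[OF lattice_J_sup this]
  moreover have "frag_of s - incl_excl x k \<in> lattice_J"
    unfolding s_def using incl_excl by (intro lattice_J_incl_excl) simp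
  \<comment> \<open>Relation for the pair \<open>s\<close>, \<open>y\<close>, minus the one for
    \<open>z\<close> of length \<open>Suc k\<close>, plus the one for \<open>x\<close> of length
    \<open>k\<close>: everything cancels except
    \<open>frag_of (inf s y) - meet_translate y (incl_excl x k)\<close>.\<close>
  ultimately have "(frag_of (sup s y) - frag_of s - frag_of y + frag_of (inf s y))
      - (frag_of (sup s y) - (incl_excl x k + frag_of y - meet_translate y (incl_excl x k)))
      + (frag_of s - incl_excl x k) \<in> lattice_J"
    by (rule lattice_J_add)
  then show ?case
    unfolding s_def[symmetric] by (simp add: meet_translate_diff inf_commute[of y] diff_diff_eq2)
next
  case zero
  then show ?case by (simp add: meet_translate_def lattice_J_zero)
next
  case (add a b)
  then show ?case by (simp add: meet_translate_def frag_extend_add lattice_J_add)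
next
  case (uminus a)
  then show ?case by (simp add: meet_translate_def frag_extend_minus lattice_J_uminus)
qed

lemma meet_mult_lattice_J: "c \<in> lattice_J \<Longrightarrow> meet_mult a c \<in> lattice_J"
  by (rule frag_induction[of a UNIV])
    (auto simp: meet_mult_diff_left meet_translate_lattice_J lattice_J_diff,
     simp add: meet_mult_def lattice_J_zero)

section \<open>Existence of the ring structure\<close>

text \<open>The additive fields are those of the free abelian group, so that the ring quotient by
  \<open>lattice_J\<close> has literally \<open>lattice_M\<close> as its additive monoid.\<close>

definition meet_ring :: "('a::bounded_lattice \<Rightarrow>\<^sub>0 int) ring" where
  "meet_ring = \<lparr>carrier = UNIV, monoid.mult = meet_mult, one = frag_of Orderings.top,
     ring.zero = 0, add = (+)\<rparr>"

lemma cring_meet_ring: "cring meet_ring"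
proof (rule cringI)
  show "abelian_group meet_ring"
    by (rule abelian_groupI) (simp_all add: meet_ring_def ac_simps, metis add.right_inverse)
  show "comm_monoid meet_ring"
    by (rule comm_monoidI)
      (simp_all add: meet_ring_def meet_mult_assoc meet_mult_top
        del: meet_mult_of_left, rule meet_mult_commute)
qed (simp add: meet_ring_def meet_mult_add_left)

lemma add_monoid_meet_ring: "add_monoid meet_ring = free_Abelian_group UNIV"
  by (simp add: meet_ring_def free_Abelian_group_def)

lemma ideal_lattice_J: "ideal lattice_J meet_ring"
proof (rule idealI)
  show "ring meet_ring" using cring_meet_ring by (rule cring.axioms)
  show "subgroup lattice_J (add_monoid meet_ring)"
    unfolding add_monoid_meet_ring by (rule lattice_J_subgroup)
qed (simp_all add: meet_ring_def meet_mult_lattice_J, metis meet_mult_commute meet_mult_lattice_J)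

abbreviation lattice_M_proj :: "('a::bounded_lattice \<Rightarrow>\<^sub>0 int) \<Rightarrow> ('a \<Rightarrow>\<^sub>0 int) set" where
  "lattice_M_proj c \<equiv> lattice_J #>\<^bsub>free_Abelian_group UNIV\<^esub> c"

lemma meet_ring_structure_Quot: "meet_ring_structure (meet_ring Quot lattice_J)"
  unfolding meet_ring_structure_def
proof (intro conjI allI)
  interpret J: ideal lattice_J meet_ring by (rule ideal_lattice_J)
  show "cring (meet_ring Quot lattice_J)"
    using cring_meet_ring by (rule J.quotient_is_cring)
  show "add_monoid (meet_ring Quot lattice_J) = lattice_M"
    by (simp add: FactRing_def lattice_M_def FactGroup_def A_RCOSETS_def set_add_def
        add_monoid_meet_ring) (simp add: meet_ring_def free_Abelian_group_def)
  have proj: "lattice_M_proj c = lattice_J +>\<^bsub>meet_ring\<^esub> c" for c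
    by (simp add: a_r_coset_def r_coset_def meet_ring_def)
  show "lattice_M_class x \<otimes>\<^bsub>meet_ring Quot lattice_J\<^esub> lattice_M_class y = lattice_M_class (inf x y)"
    for x y
    using J.rcoset_mult_add[of "frag_of x" "frag_of y"]
    by (simp add: lattice_M_class_def proj FactRing_def) (simp add: meet_ring_def)
qed


section \<open>Arbitrary ring structures induced by meet\<close>

lemma lattice_M_proj_eq_iff: "lattice_M_proj a = lattice_M_proj b \<longleftrightarrow> a - b \<in> lattice_J"
proof -
  have mem: "c \<in> lattice_M_proj b \<longleftrightarrow> c - b \<in> lattice_J" for b c :: "'a \<Rightarrow>\<^sub>0 int"
    by (force simp: r_coset_def)
  show ?thesis
  proof
    assume "lattice_M_proj a = lattice_M_proj b"
    then show "a - b \<in> lattice_J"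
      using mem[of a a] mem[of a b] by (simp add: lattice_J_zero)
  next
    assume *: "a - b \<in> lattice_J"
    have "c - a \<in> lattice_J \<longleftrightarrow> c - b \<in> lattice_J" for c
      using lattice_J_add[OF _ *, of "c - a"] lattice_J_diff[OF _ *, of "c - b"] by auto
    then show "lattice_M_proj a = lattice_M_proj b"
      by (auto simp: mem)
  qed
qed

lemma carrier_lattice_M: "carrier lattice_M = range lattice_M_proj"
  by (auto simp: lattice_M_def carrier_FactGroup)

text \<open>Working with any such \<open>R\<close>, not only the quotient constructed above, gives
  uniqueness, the isomorphism and functoriality for all of them at once.\<close>

locale lattice_M_ring =
  fixes R :: "('a::bounded_lattice \<Rightarrow>\<^sub>0 int) set ring" (structure)
  assumes meet_structure: "meet_ring_structure R"

sublocale lattice_M_ring \<subseteq> cring R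
  using meet_structure by (simp add: meet_ring_structure_def)

context lattice_M_ring
begin

lemma add_monoid_eq: "add_monoid R = lattice_M"
  using meet_structure by (simp add: meet_ring_structure_def)

lemma carrier_eq: "carrier R = range lattice_M_proj"
  using arg_cong[OF add_monoid_eq, of carrier] by (simp add: carrier_lattice_M)

lemma proj_closed [simp]: "lattice_M_proj c \<in> carrier R"
  by (simp add: carrier_eq)

lemma proj_add: "lattice_M_proj (a + b) = lattice_M_proj a \<oplus> lattice_M_proj b"
  using arg_cong[OF add_monoid_eq, of monoid.mult]
    normal.rcos_sum[OF lattice_J_normal, of a b]
  by (simp add: lattice_M_def FactGroup_def)

lemma proj_zero: "lattice_M_proj 0 = \<zero>"
  \<comment> \<open>The class of 0 is idempotent under addition, hence zero.\<close>
  using proj_add[of 0 0] by (metis add.l_cancel_one' add_0 proj_closed)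

lemma proj_uminus: "lattice_M_proj (- a) = \<ominus> lattice_M_proj a"
  by (rule minus_equality[symmetric]) (simp_all add: proj_zero flip: proj_add)

lemma proj_diff: "lattice_M_proj (a - b) = lattice_M_proj a \<ominus> lattice_M_proj b"
  using proj_add[of a "- b"] by (simp add: proj_uminus a_minus_def)

text \<open>Distributivity in \<open>R\<close> reduces both factors to generators, where the product
  is prescribed. Hence the multiplication on classes is the same for every \<open>R\<close>.\<close>

lemma proj_mult: "lattice_M_proj (meet_mult a b) = lattice_M_proj a \<otimes> lattice_M_proj b"
proof (rule frag_induction[of a UNIV])
  show "lattice_M_proj (meet_mult 0 b) = lattice_M_proj 0 \<otimes> lattice_M_proj b"
    by (simp add: meet_mult_def proj_zero)
next
  fix x
  show "lattice_M_proj (meet_mult (frag_of x) b) = lattice_M_proj (frag_of x) \<otimes> lattice_M_proj b"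
  proof (rule frag_induction[of b UNIV])
    show "lattice_M_proj (meet_mult (frag_of x) 0) = lattice_M_proj (frag_of x) \<otimes> lattice_M_proj 0"
      by (simp add: meet_translate_def proj_zero)
  next
    fix y
    show "lattice_M_proj (meet_mult (frag_of x) (frag_of y))
        = lattice_M_proj (frag_of x) \<otimes> lattice_M_proj (frag_of y)"
      using meet_structure by (simp add: meet_ring_structure_def lattice_M_class_def)
  qed (auto simp: meet_translate_diff proj_diff a_minus_def r_distr r_minus)
qed (auto simp: meet_mult_diff_left proj_diff a_minus_def l_distr l_minus)

text \<open>The class of the top element is neutral on all classes, in particular on a
  representative \<open>e\<close> of the unit, so it equals the unit.\<close>

lemma one_eq: "\<one> = lattice_M_proj (frag_of Orderings.top)"
proof -
  obtain e where e: "\<one> = lattice_M_proj e"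
    using one_closed by (auto simp: carrier_eq)
  have "lattice_M_proj (frag_of Orderings.top) = lattice_M_proj (frag_of Orderings.top) \<otimes> \<one>"
    by simp
  also have "\<dots> = \<one>"
    unfolding e by (metis proj_mult meet_mult_top)
  finally show ?thesis ..
qed

end

section \<open>From polynomials to formal sums of lattice elements\<close>

text \<open>Exponents may be forgotten because meet is idempotent. Inserting the top element keeps
  the set nonempty and gives the constant monomial its value.\<close>

definition monomial_meet :: "('a::bounded_lattice \<Rightarrow>\<^sub>0 nat) \<Rightarrow> 'a" where
  "monomial_meet m = Inf_fin (insert Orderings.top (Poly_Mapping.keys m))"

lemma monomial_meet_add: "monomial_meet (m + n) = inf (monomial_meet m) (monomial_meet n)"
proof -
  \<comment> \<open>Natural exponents cannot cancel.\<close>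
  have "Poly_Mapping.keys (m + n) = Poly_Mapping.keys m \<union> Poly_Mapping.keys n"
    by (auto simp: in_keys_iff lookup_add)
  then have "insert Orderings.top (Poly_Mapping.keys (m + n)) =
      insert Orderings.top (Poly_Mapping.keys m) \<union> insert Orderings.top (Poly_Mapping.keys n)"
    by auto
  then show ?thesis
    unfolding monomial_meet_def by (simp only:) (rule Inf_fin.union; simp)
qed

lemma monomial_meet_zero [simp]: "monomial_meet 0 = Orderings.top"
  by (simp add: monomial_meet_def)

lemma monomial_meet_var [simp]: "monomial_meet (Poly_Mapping.single x (Suc 0)) = x"
  by (simp add: monomial_meet_def)

text \<open>Integer polynomials are also elements of the free abelian group on monomials:
  \<open>frag_of m\<close> is the monomial \<open>m\<close> with coefficient 1, and
  \<open>frag_extend\<close> extends linearly from monomials.\<close>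

definition poly_to_frag :: "'a::bounded_lattice int_mpoly \<Rightarrow> ('a \<Rightarrow>\<^sub>0 int)" where
  "poly_to_frag = frag_extend (\<lambda>m. frag_of (monomial_meet m))"

lemma poly_to_frag_add: "poly_to_frag (p + q) = poly_to_frag p + poly_to_frag q"
  by (simp add: poly_to_frag_def frag_extend_add)

lemma poly_to_frag_diff: "poly_to_frag (p - q) = poly_to_frag p - poly_to_frag q"
  by (simp add: poly_to_frag_def frag_extend_diff)

lemma poly_to_frag_of [simp]: "poly_to_frag (frag_of m) = frag_of (monomial_meet m)"
  by (simp add: poly_to_frag_def)

lemma poly_to_frag_var [simp]: "poly_to_frag (int_var x) = frag_of x"
  by (simp add: int_var_def)

lemma poly_to_frag_one: "poly_to_frag 1 = frag_of Orderings.top"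
  using poly_to_frag_of[of 0] by (simp del: poly_to_frag_of)

lemma poly_to_frag_mult: "poly_to_frag (p * q) = meet_mult (poly_to_frag p) (poly_to_frag q)"
proof (rule frag_eq_on_generators[where c = p])
  fix m
  show "poly_to_frag (frag_of m * q) = meet_mult (poly_to_frag (frag_of m)) (poly_to_frag q)"
    by (rule frag_eq_on_generators[where c = q])
      (simp_all add: right_diff_distrib poly_to_frag_diff meet_translate_diff mult_single
        monomial_meet_add)
qed (simp_all add: left_diff_distrib poly_to_frag_diff meet_mult_diff_left)

section \<open>Congruences modulo the ideal of the polynomial ring\<close>

lemma cring_int_mpoly_ring: "cring int_mpoly_ring"
  unfolding int_mpoly_ring_def by (rule cring_from_type_algebra)

lemma int_mpoly_ring_simps [simp]:
  "carrier int_mpoly_ring = UNIV" "p \<otimes>\<^bsub>int_mpoly_ring\<^esub> q = p * q" "\<one>\<^bsub>int_mpoly_ring\<^esub> = 1"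
  "p \<oplus>\<^bsub>int_mpoly_ring\<^esub> q = p + q" "\<zero>\<^bsub>int_mpoly_ring\<^esub> = 0"
  by (simp_all add: int_mpoly_ring_def ring_of_type_algebra_def)

lemma ideal_lattice_ideal: "ideal lattice_ideal int_mpoly_ring"
  unfolding lattice_ideal_def
  by (rule ring.genideal_ideal) (simp_all add: cring.axioms(1)[OF cring_int_mpoly_ring])

lemma lattice_ideal_generators:
  "int_var bot \<in> lattice_ideal" "int_var Orderings.top - 1 \<in> lattice_ideal"
  "int_var (inf x y) - int_var x * int_var y \<in> lattice_ideal"
  "int_var (sup x y) - int_var x - int_var y + int_var x * int_var y \<in> lattice_ideal"
proof -
  note * = ring.genideal_self[OF cring.axioms(1)[OF cring_int_mpoly_ring], unfolded int_mpoly_ring_simps,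
    OF subset_UNIV, THEN subsetD, folded lattice_ideal_def]
  show "int_var bot \<in> lattice_ideal" "int_var Orderings.top - 1 \<in> lattice_ideal"
    "int_var (inf x y) - int_var x * int_var y \<in> lattice_ideal"
    "int_var (sup x y) - int_var x - int_var y + int_var x * int_var y \<in> lattice_ideal"
    unfolding lattice_ideal_def by (rule *; blast)+
qed

lemma lattice_ideal_add: "p \<in> lattice_ideal \<Longrightarrow> q \<in> lattice_ideal \<Longrightarrow> p + q \<in> lattice_ideal"
  using additive_subgroup.a_closed[OF ideal.axioms(1)[OF ideal_lattice_ideal], of p q] by simp

lemma lattice_ideal_mult: "p \<in> lattice_ideal \<Longrightarrow> q * p \<in> lattice_ideal"
  using ideal.I_l_closed[OF ideal_lattice_ideal, of p q] by simp

lemma lattice_ideal_zero: "0 \<in> lattice_ideal"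
  using lattice_ideal_mult[OF lattice_ideal_generators(1), of 0] by simp

lemma lattice_ideal_uminus: "p \<in> lattice_ideal \<Longrightarrow> - p \<in> lattice_ideal"
  using lattice_ideal_mult[of p "- 1"] by simp

lemma lattice_ideal_diff: "p \<in> lattice_ideal \<Longrightarrow> q \<in> lattice_ideal \<Longrightarrow> p - q \<in> lattice_ideal"
  using lattice_ideal_add[of p "- q"] lattice_ideal_uminus[of q] by simp

text \<open>Linear extension in \<open>c\<close> of the generator of the ideal that equates the
  variable of a meet with a product of variables.\<close>

lemma frag_extend_var_meet_translate:
  "frag_extend int_var (meet_translate y c) - int_var y * frag_extend int_var c \<in> lattice_ideal"
proof (rule frag_induction[of c UNIV])
  fix a b
  assume "frag_extend int_var (meet_translate y a) - int_var y * frag_extend int_var a \<in> lattice_ideal"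
    and "frag_extend int_var (meet_translate y b) - int_var y * frag_extend int_var b \<in> lattice_ideal"
  from lattice_ideal_diff[OF this]
  show "frag_extend int_var (meet_translate y (a - b)) - int_var y * frag_extend int_var (a - b)
      \<in> lattice_ideal"
    by (simp add: meet_translate_diff frag_extend_diff algebra_simps)
qed (simp_all add: lattice_ideal_generators lattice_ideal_zero, simp add: meet_translate_def lattice_ideal_zero)

lemma lattice_ideal_incl_excl:
  "k \<ge> 1 \<Longrightarrow> int_var (Sup_fin (x ` {1..k})) - frag_extend int_var (incl_excl x k) \<in> lattice_ideal"
proof (induction k rule: nat_induct_at_least)
  case base
  then show ?case by (simp add: lattice_ideal_zero)
next
  case (Suc k)
  let ?y = "x (Suc k)" and ?s = "Sup_fin (x ` {1..k})" and ?E = "frag_extend int_var (incl_excl x k)"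
  let ?T = "frag_extend int_var (meet_translate ?y (incl_excl x k))"
  \<comment> \<open>Modulo the ideal, \<open>sup ?s ?y\<close> becomes
    \<open>?y + (1 - ?y) * ?s\<close>, then \<open>?s\<close> is replaced by \<open>?E\<close> and
    \<open>?y * ?E\<close> by \<open>?T\<close>. The sum on the left expands to the claim for
    \<open>Suc k\<close>.\<close>
  have "(int_var (sup ?s ?y) - int_var ?s - int_var ?y + int_var ?s * int_var ?y)
      + (1 - int_var ?y) * (int_var ?s - ?E) + (?T - int_var ?y * ?E) \<in> lattice_ideal"
    by (rule lattice_ideal_add[OF lattice_ideal_add[OF lattice_ideal_generators(4)
          lattice_ideal_mult[OF Suc.IH]] frag_extend_var_meet_translate])
  then show ?case
    unfolding Sup_fin_atLeastAtMost_Suc[OF Suc.hyps] incl_excl_Suc frag_extend_add frag_extend_diff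
    by (simp add: algebra_simps)
qed

lemma frag_extend_var_lattice_J: "c \<in> lattice_J \<Longrightarrow> frag_extend int_var c \<in> lattice_ideal"
  by (induction rule: lattice_J_induct)
    (simp_all add: lattice_ideal_generators lattice_ideal_zero frag_extend_add frag_extend_minus
      frag_extend_diff lattice_ideal_add lattice_ideal_uminus lattice_ideal_incl_excl
      del: One_nat_def)

text \<open>Modulo the ideal a product of variables is the variable of their meet, and 1 is the
  variable of the top element. The claim is multiplicative in \<open>m\<close>, so it is built up
  from powers of single variables.\<close>

lemma monomial_cong_var: "frag_of m - int_var (monomial_meet m) \<in> lattice_ideal"
proof (induction m rule: update_induct)
  case const
  show ?case
    using lattice_ideal_uminus[OF lattice_ideal_generators(2)] by simp
next
  case (update m x b)
  have add: "frag_of (m + n) - int_var (monomial_meet (m + n)) \<in> lattice_ideal"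
    if "frag_of m - int_var (monomial_meet m) \<in> lattice_ideal"
      "frag_of n - int_var (monomial_meet n) \<in> lattice_ideal" for m n :: "'a \<Rightarrow>\<^sub>0 nat"
  proof -
    \<comment> \<open>Replace first \<open>n\<close>, then \<open>m\<close>, by the variable of its
      meet, then merge the two variables by a meet generator.\<close>
    have "frag_of m * (frag_of n - int_var (monomial_meet n))
        + int_var (monomial_meet n) * (frag_of m - int_var (monomial_meet m))
        - (int_var (inf (monomial_meet m) (monomial_meet n))
            - int_var (monomial_meet m) * int_var (monomial_meet n)) \<in> lattice_ideal"
      by (rule lattice_ideal_diff[OF lattice_ideal_add[OF lattice_ideal_mult[OF that(2)]
            lattice_ideal_mult[OF that(1)]] lattice_ideal_generators(3)])
    moreover have "frag_of (m + n) = frag_of m * frag_of n"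
      by (simp add: mult_single)
    ultimately show ?thesis
      by (simp add: monomial_meet_add algebra_simps)
  qed
  have "frag_of (Poly_Mapping.single x b) - int_var (monomial_meet (Poly_Mapping.single x b))
      \<in> lattice_ideal"
  proof (induction b)
    case 0
    show ?case
      using lattice_ideal_uminus[OF lattice_ideal_generators(2)] by simp
  next
    case (Suc b)
    have "Poly_Mapping.single x (Suc b) = Poly_Mapping.single x 1 + Poly_Mapping.single x b"
      by (simp flip: single_add)
    moreover have "frag_of (Poly_Mapping.single x 1)
        - int_var (monomial_meet (Poly_Mapping.single x 1)) \<in> lattice_ideal"
      by (simp add: int_var_def lattice_ideal_zero)
    ultimately show ?case
      using add Suc.IH by metis
  qed
  \<comment> \<open>The index \<open>x\<close> is not yet a key of \<open>m\<close>, so updating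
    amounts to adding.\<close>
  moreover have "Poly_Mapping.update x b m = Poly_Mapping.single x b + m"
    using update.hyps
    by (intro poly_mapping_eqI) (auto simp: lookup_update lookup_add lookup_single in_keys_iff)
  ultimately show ?case
    using add update.IH by simp
qed

lemma poly_cong_linear: "p - frag_extend int_var (poly_to_frag p) \<in> lattice_ideal"
proof (rule frag_induction[of p UNIV])
  fix p q :: "'a int_mpoly"
  assume "p - frag_extend int_var (poly_to_frag p) \<in> lattice_ideal"
    and "q - frag_extend int_var (poly_to_frag q) \<in> lattice_ideal"
  from lattice_ideal_diff[OF this]
  show "p - q - frag_extend int_var (poly_to_frag (p - q)) \<in> lattice_ideal"
    by (simp add: poly_to_frag_diff frag_extend_diff algebra_simps)
qed (simp_all add: monomial_cong_var, simp add: poly_to_frag_def lattice_ideal_zero)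

section \<open>Kernel and image of the map from polynomials\<close>

context lattice_M_ring
begin

lemma ring_hom_poly: "ring_hom_ring int_mpoly_ring R (\<lambda>p. lattice_M_proj (poly_to_frag p))"
  by (rule ring_hom_ringI)
    (simp_all add: cring.axioms(1)[OF cring_int_mpoly_ring] ring_axioms poly_to_frag_add
      poly_to_frag_mult poly_to_frag_one proj_add proj_mult one_eq)

lemma kernel_poly: "a_kernel int_mpoly_ring R (\<lambda>p. lattice_M_proj (poly_to_frag p)) = lattice_ideal"
proof
  interpret h: ring_hom_ring int_mpoly_ring R "\<lambda>p. lattice_M_proj (poly_to_frag p)"
    by (rule ring_hom_poly)
  have ker: "p \<in> a_kernel int_mpoly_ring R (\<lambda>p. lattice_M_proj (poly_to_frag p))
      \<longleftrightarrow> poly_to_frag p \<in> lattice_J" for p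
    unfolding a_kernel_def' by (simp add: lattice_M_proj_eq_iff flip: proj_zero)
  show "lattice_ideal \<subseteq> a_kernel int_mpoly_ring R (\<lambda>p. lattice_M_proj (poly_to_frag p))"
    unfolding lattice_ideal_def
    by (rule h.R.genideal_minimal[OF h.kernel_is_ideal], rule subsetI, unfold ker)
      (auto simp: poly_to_frag_add poly_to_frag_diff poly_to_frag_mult poly_to_frag_one
        lattice_J_bot lattice_J_sup lattice_J_zero)
  show "a_kernel int_mpoly_ring R (\<lambda>p. lattice_M_proj (poly_to_frag p)) \<subseteq> lattice_ideal"
  proof
    fix p assume "p \<in> a_kernel int_mpoly_ring R (\<lambda>p. lattice_M_proj (poly_to_frag p))"
    then have "frag_extend int_var (poly_to_frag p) \<in> lattice_ideal"
      by (intro frag_extend_var_lattice_J) (simp add: ker)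
    \<comment> \<open>Modulo the ideal \<open>p\<close> equals its linear form
      \<open>frag_extend int_var (poly_to_frag p)\<close>, which lies in the ideal because
      \<open>poly_to_frag p\<close> lies in \<open>lattice_J\<close>.\<close>
    from lattice_ideal_add[OF poly_cong_linear[of p] this] show "p \<in> lattice_ideal"
      by simp
  qed
qed

lemma iso_poly_Quot: "R \<simeq> int_mpoly_ring Quot (lattice_ideal :: 'a int_mpoly set)"
proof -
  \<comment> \<open>Linear polynomials give a section of \<open>poly_to_frag\<close>, whence
    surjectivity.\<close>
  have "poly_to_frag (frag_extend int_var c) = c" for c :: "'a \<Rightarrow>\<^sub>0 int"
    by (rule frag_eq_on_generators[where c = c]) (simp_all add: frag_extend_diff poly_to_frag_diff)
  then have "(\<lambda>p. lattice_M_proj (poly_to_frag p)) ` carrier int_mpoly_ring = carrier R"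
    unfolding carrier_eq int_mpoly_ring_simps by (metis surj_def image_image)
  then have "int_mpoly_ring Quot (lattice_ideal :: 'a int_mpoly set) \<simeq> R"
    using ring_hom_ring.FactRing_iso[OF ring_hom_poly] by (simp add: kernel_poly)
  then show ?thesis
    by (rule ring_iso_sym[OF ideal.quotient_is_ring[OF ideal_lattice_ideal]])
qed

end

section \<open>Functoriality\<close>

text \<open>A morphism commutes with finite nonempty joins and meets, so it carries the relation of
  a family \<open>x\<close> to that of \<open>f \<circ> x\<close>.\<close>

lemma frag_extend_hom_lattice_J:
  assumes f: "bounded_lattice_hom f" and c: "c \<in> lattice_J"
  shows "frag_extend (\<lambda>x. frag_of (f x)) c \<in> lattice_J"
  using c
proof (induction rule: lattice_J_induct)
  case bot
  then show ?case using f by (simp add: bounded_lattice_hom_def lattice_J_bot)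
next
  case (incl_excl x k)
  have "f (Sup_fin (x ` {1..k})) = Sup_fin ((f \<circ> x) ` {1..k})"
    using f incl_excl by (simp add: bounded_lattice_hom_def Sup_fin_hom image_comp)
  moreover have "frag_extend (\<lambda>x. frag_of (f x)) (incl_excl x k) = incl_excl (f \<circ> x) k"
    using f by (intro frag_extend_incl_excl) (simp add: bounded_lattice_hom_def)
  ultimately show ?case
    using lattice_J_incl_excl[of k "f \<circ> x"] incl_excl by (simp add: frag_extend_diff)
qed (simp_all add: lattice_J_zero lattice_J_add lattice_J_uminus frag_extend_add frag_extend_minus)

text \<open>Representatives of one class differ by an element of \<open>lattice_J\<close>, whose
  image lies in \<open>lattice_J\<close> again; all cosets in the defining union therefore
  coincide.\<close>

lemma lattice_M_map_proj:
  assumes f: "bounded_lattice_hom f"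
  shows "lattice_M_map f (lattice_M_proj c) = lattice_M_proj (frag_extend (\<lambda>x. frag_of (f x)) c)"
proof -
  have "lattice_M_proj (frag_extend (\<lambda>x. frag_of (f x)) d)
      = lattice_M_proj (frag_extend (\<lambda>x. frag_of (f x)) c)" if "d \<in> lattice_M_proj c" for d
  proof -
    have "d - c \<in> lattice_J"
      using that by (auto simp: r_coset_def)
    then show ?thesis
      by (simp add: lattice_M_proj_eq_iff frag_extend_hom_lattice_J[OF f] flip: frag_extend_diff)
  qed
  moreover have "c \<in> lattice_M_proj c"
    using lattice_J_zero by (force simp: r_coset_def)
  ultimately show ?thesis
    unfolding lattice_M_map_def by blast
qed

lemma frag_extend_meet_mult:
  assumes f: "\<And>x y. f (inf x y) = inf (f x) (f y)"
  shows "frag_extend (\<lambda>x. frag_of (f x)) (meet_mult a b) =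
    meet_mult (frag_extend (\<lambda>x. frag_of (f x)) a) (frag_extend (\<lambda>x. frag_of (f x)) b)"
proof (rule frag_eq_on_generators[where c = a])
  fix x
  show "frag_extend (\<lambda>x. frag_of (f x)) (meet_mult (frag_of x) b) =
    meet_mult (frag_extend (\<lambda>x. frag_of (f x)) (frag_of x)) (frag_extend (\<lambda>x. frag_of (f x)) b)"
    by (rule frag_eq_on_generators[where c = b])
      (simp_all add: meet_translate_diff frag_extend_diff f)
qed (simp_all add: meet_mult_diff_left frag_extend_diff)

lemma lattice_M_map_ring_hom:
  assumes f: "bounded_lattice_hom f" and "meet_ring_structure R" "meet_ring_structure R'"
  shows "lattice_M_map f \<in> ring_hom R R'"
proof -
  interpret R: lattice_M_ring R by standard fact
  interpret R': lattice_M_ring R' by standard fact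
  have inf: "f (inf x y) = inf (f x) (f y)" for x y
    using f by (simp add: bounded_lattice_hom_def)
  show ?thesis
  proof (rule ring_hom_memI)
    show "lattice_M_map f \<one>\<^bsub>R\<^esub> = \<one>\<^bsub>R'\<^esub>"
      using f by (simp add: R.one_eq R'.one_eq lattice_M_map_proj bounded_lattice_hom_def)
  qed (auto simp: R.carrier_eq lattice_M_map_proj[OF f] frag_extend_add frag_extend_meet_mult[OF inf]
      R'.proj_add R'.proj_mult simp flip: R.proj_add R.proj_mult)
qed

theorem theorem9:
  shows
    "(\<exists>R :: ('a::bounded_lattice \<Rightarrow>\<^sub>0 int) set ring. meet_ring_structure R) \<and>
     (\<forall>R S :: ('a \<Rightarrow>\<^sub>0 int) set ring. meet_ring_structure R \<longrightarrow> meet_ring_structure S \<longrightarrow>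
        \<one>\<^bsub>R\<^esub> = \<one>\<^bsub>S\<^esub> \<and>
        (\<forall>C\<in>carrier lattice_M. \<forall>D\<in>carrier lattice_M. C \<otimes>\<^bsub>R\<^esub> D = C \<otimes>\<^bsub>S\<^esub> D)) \<and>
     (\<forall>R :: ('a \<Rightarrow>\<^sub>0 int) set ring. meet_ring_structure R \<longrightarrow>
        R \<simeq> int_mpoly_ring Quot (lattice_ideal :: 'a int_mpoly set)) \<and>
     (\<forall>(f :: 'a \<Rightarrow> 'b::bounded_lattice) R R'.
        bounded_lattice_hom f \<longrightarrow> meet_ring_structure R \<longrightarrow> meet_ring_structure R' \<longrightarrow>
        lattice_M_map f \<in> ring_hom R R' \<and>
        (\<forall>x. lattice_M_map f (lattice_M_class x) = lattice_M_class (f x))) \<and>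
     (\<forall>C\<in>carrier lattice_M. lattice_M_map (id :: 'a \<Rightarrow> 'a) C = C) \<and>
     (\<forall>(f :: 'a \<Rightarrow> 'b) (g :: 'b \<Rightarrow> 'c::bounded_lattice).
        bounded_lattice_hom f \<longrightarrow> bounded_lattice_hom g \<longrightarrow>
        (\<forall>C\<in>carrier lattice_M. lattice_M_map (g \<circ> f) C = lattice_M_map g (lattice_M_map f C)))"
proof (intro conjI allI impI ballI)
  show "\<exists>R :: ('a \<Rightarrow>\<^sub>0 int) set ring. meet_ring_structure R"
    using meet_ring_structure_Quot by blast
next
  fix R S :: "('a \<Rightarrow>\<^sub>0 int) set ring"
  assume "meet_ring_structure R" "meet_ring_structure S"
  then interpret R: lattice_M_ring R + S: lattice_M_ring S
    by (simp_all add: lattice_M_ring_def)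
  show "\<one>\<^bsub>R\<^esub> = \<one>\<^bsub>S\<^esub>"
    by (simp add: R.one_eq S.one_eq)
  fix C D :: "('a \<Rightarrow>\<^sub>0 int) set"
  assume "C \<in> carrier lattice_M" "D \<in> carrier lattice_M"
  then show "C \<otimes>\<^bsub>R\<^esub> D = C \<otimes>\<^bsub>S\<^esub> D"
    by (auto simp: carrier_lattice_M simp flip: R.proj_mult S.proj_mult)
next
  fix R :: "('a \<Rightarrow>\<^sub>0 int) set ring"
  assume "meet_ring_structure R"
  then show "R \<simeq> int_mpoly_ring Quot (lattice_ideal :: 'a int_mpoly set)"
    by (intro lattice_M_ring.iso_poly_Quot lattice_M_ring.intro)
next
  fix f :: "'a \<Rightarrow> 'b" and R :: "('a \<Rightarrow>\<^sub>0 int) set ring" and R' :: "('b \<Rightarrow>\<^sub>0 int) set ring"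
  assume "bounded_lattice_hom f" "meet_ring_structure R" "meet_ring_structure R'"
  then show "lattice_M_map f \<in> ring_hom R R'"
    by (rule lattice_M_map_ring_hom)
next
  fix f :: "'a \<Rightarrow> 'b" and x
  assume "bounded_lattice_hom f"
  then show "lattice_M_map f (lattice_M_class x) = lattice_M_class (f x)"
    by (simp add: lattice_M_class_def lattice_M_map_proj)
next
  fix C :: "('a \<Rightarrow>\<^sub>0 int) set"
  assume "C \<in> carrier lattice_M"
  moreover have "bounded_lattice_hom (id :: 'a \<Rightarrow> 'a)"
    by (simp add: bounded_lattice_hom_def)
  ultimately show "lattice_M_map id C = C"
    \<comment> \<open>By \<open>frag_expansion\<close>, the linear extension of
      \<open>frag_of\<close> is the identity.\<close>
    by (auto simp: carrier_lattice_M lattice_M_map_proj simp flip: frag_expansion)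
next
  fix f :: "'a \<Rightarrow> 'b" and g :: "'b \<Rightarrow> 'c" and C :: "('a \<Rightarrow>\<^sub>0 int) set"
  assume f: "bounded_lattice_hom f" and g: "bounded_lattice_hom g" and "C \<in> carrier lattice_M"
  then obtain c where C: "C = lattice_M_proj c"
    by (auto simp: carrier_lattice_M)
  have "bounded_lattice_hom (g \<circ> f)"
    using f g by (simp add: bounded_lattice_hom_def)
  then show "lattice_M_map (g \<circ> f) C = lattice_M_map g (lattice_M_map f C)"
    using frag_extend_compose[of "\<lambda>x. frag_of (g x)" f c]
    by (simp add: C lattice_M_map_proj f g comp_def)
qed

end
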